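(* Let $p$ be an odd prime and $a$ a rational number with denominator not divisible by $p$ such that $p\nmid(16a^2-1)$. Then $$\sum_{k=0}^{[p/4]}\binom{4k}{2k}a^{2k}\equiv\begin{cases}0\pmod p&\text{if }\big(\frac{1-16a^2}p\big)=-1,\\ \big(\frac{1-4a}p\big)\pmod p&\text{if }\big(\frac{1-16a^2}p\big)=1.\end{cases}$$
   Context: $[x]$ is the greatest integer not exceeding $x$. For a rational $r$ with denominator prime to $p$, $\big(\frac rp\big)$ is the Legendre symbol of its residue mod $p$; congruences are in the ring of such rationals. *)

theory Defs
  imports Complex_Main "HOL-Number_Theory.Number_Theory"
begin

definition rat_p_integral :: "nat \<Rightarrow> rat \<Rightarrow> bool" where
  "rat_p_integral p r \<longleftrightarrow> \<not> int p dvd snd (quotient_of r)"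

text \<open>Divisibility by \<open>p\<close> and congruence modulo \<open>p\<close> are those of the ring of rationals
  with denominator prime to \<open>p\<close>; the predicates are false outside that ring.\<close>

definition rat_p_dvd :: "nat \<Rightarrow> rat \<Rightarrow> bool" where
  "rat_p_dvd p r \<longleftrightarrow> (\<exists>t. rat_p_integral p t \<and> r = of_nat p * t)"

definition rat_cong :: "rat \<Rightarrow> rat \<Rightarrow> nat \<Rightarrow> bool" where
  "rat_cong r s p \<longleftrightarrow> rat_p_integral p r \<and> rat_p_integral p s \<and> rat_p_dvd p (r - s)"

definition rat_residue :: "nat \<Rightarrow> rat \<Rightarrow> int" where
  "rat_residue p r = (THE m. 0 \<le> m \<and> m < int p \<and> rat_cong r (of_int m) p)"

definition rat_Legendre :: "rat \<Rightarrow> nat \<Rightarrow> int" where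
  "rat_Legendre r p = Legendre (rat_residue p r) (int p)"

lemma rat_p_integral_Fract:
  assumes "\<not> int p dvd b"
  shows "rat_p_integral p (of_int a / of_int b)"
proof -
  obtain c d where cd: "quotient_of (of_int a / of_int b) = (c, d)" by force
  have d: "d > 0" and cop: "coprime c d" and eq: "of_int a / of_int b = (of_int c / of_int d :: rat)"
    using quotient_of_denom_pos[OF cd] quotient_of_coprime[OF cd] quotient_of_div[OF cd] by auto
  have b: "b \<noteq> 0" using assms by auto
  have "(of_int (a * d) :: rat) = of_int (c * b)" using eq b d by (simp add: field_simps)
  then have "a * d = c * b" by (simp only: of_int_eq_iff)
  then have "d dvd c * b" by (metis dvd_triv_right)
  then have "d dvd b" using cop by (simp add: coprime_commute coprime_dvd_mult_right_iff)
  then show ?thesis using assms cd unfolding rat_p_integral_def by auto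
qed

lemma rat_p_integral_of_int: "prime p \<Longrightarrow> rat_p_integral p (of_int m)"
  using rat_p_integral_Fract[of p 1 m] prime_gt_1_nat[of p] by simp

lemma rat_residue_ex1:
  assumes p: "prime p" and r: "rat_p_integral p r"
  shows "\<exists>!m. 0 \<le> m \<and> m < int p \<and> rat_cong r (of_int m) p"
proof -
  obtain c d where cd: "quotient_of r = (c, d)" by force
  have d: "d > 0" and eq: "r = of_int c / of_int d"
    using quotient_of_denom_pos[OF cd] quotient_of_div[OF cd] by auto
  have pd: "\<not> int p dvd d" using r cd by (simp add: rat_p_integral_def)
  have pp: "prime (int p)" using p by simp
  have pos: "int p > 0" using p prime_gt_0_nat by simp
  have key: "rat_cong r (of_int m) p \<longleftrightarrow> int p dvd c - m * d" for m
  proof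
    assume "rat_cong r (of_int m) p"
    then obtain t where t: "rat_p_integral p t" "r - of_int m = of_nat p * t"
      by (auto simp: rat_cong_def rat_p_dvd_def)
    obtain u v where uv: "quotient_of t = (u, v)" by force
    have v: "v > 0" "t = of_int u / of_int v"
      using quotient_of_denom_pos[OF uv] quotient_of_div[OF uv] by auto
    have pv: "\<not> int p dvd v" using t uv by (simp add: rat_p_integral_def)
    have "(of_int ((c - m * d) * v) :: rat) = of_int (int p * (u * d))"
      using t(2) eq v d by (simp add: field_simps)
    then have "(c - m * d) * v = int p * (u * d)" by (simp only: of_int_eq_iff)
    then have "int p dvd (c - m * d) * v" by simp
    then show "int p dvd c - m * d" using pv pp prime_dvd_mult_iff by blast
  next
    assume "int p dvd c - m * d"
    then obtain k where k: "c - m * d = int p * k" by blast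
    have "r - of_int m = of_int (c - m * d) / of_int d" using eq d by (simp add: field_simps)
    also have "\<dots> = of_nat p * (of_int k / of_int d)" by (simp add: k)
    finally show "rat_cong r (of_int m) p"
      unfolding rat_cong_def rat_p_dvd_def
      using r rat_p_integral_Fract[OF pd] rat_p_integral_of_int[OF p] by blast
  qed
  have "coprime d (int p)" using prime_imp_coprime[OF pp pd] by (simp add: coprime_commute)
  then obtain e where e: "[d * e = 1] (mod int p)" using cong_solve_coprime_int by blast
  show ?thesis
  proof (rule ex1I[of _ "(c * e) mod int p"], intro conjI)
    have "[(c * e) mod int p * d = c * (d * e)] (mod int p)"
      by (simp add: cong_def mod_mult_left_eq) (simp add: ac_simps)
    also have "[c * (d * e) = c * 1] (mod int p)" using e by (rule cong_scalar_left)
    finally have "int p dvd c - (c * e) mod int p * d"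
      by (simp add: cong_iff_dvd_diff dvd_diff_commute)
    then show "rat_cong r (of_int ((c * e) mod int p)) p" by (simp only: key)
    fix m assume m: "0 \<le> m \<and> m < int p \<and> rat_cong r (of_int m) p"
    then have "[c = m * d] (mod int p)" using key by (simp add: cong_iff_dvd_diff)
    then have "[c * e = m * d * e] (mod int p)" by (rule cong_scalar_right)
    also have "[m * d * e = m * 1] (mod int p)"
      using cong_scalar_left[OF e, of m] by (simp add: mult.assoc)
    finally show "m = (c * e) mod int p" using m by (simp add: cong_def)
  qed (use pos in auto)
qed

end

theory Submission imports Defs begin

text \<open>Modulo an odd prime \<open>p = 2n + 1\<close> one has
  \<open>binom(2j, j) = (-4)^j binom(n, j)\<close> for \<open>j \<le> n\<close>, so the generating polynomial of the central
  binomial coefficients, cut off at degree \<open>n\<close>, is \<open>(1 - 4x)^n\<close>. Its even part, evaluated at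
  \<open>a\<close>, is the sum in question; by Euler's criterion twice that sum is
  \<open>((1 - 4a)/p) + ((1 + 4a)/p)\<close>, and the product of these two symbols is \<open>((1 - 16a\<^sup>2)/p)\<close>.\<close>

section \<open>The ring of rationals with denominator prime to \<open>p\<close>\<close>

text \<open>Frees the notion from lowest terms: closure under sums and products can then be checked
  on any fraction whose denominator is prime to \<open>p\<close>.\<close>

lemma rat_p_integral_iff:
  "rat_p_integral p r \<longleftrightarrow> (\<exists>u v. \<not> int p dvd v \<and> r = of_int u / of_int v)"
proof
  assume r: "rat_p_integral p r"
  obtain u v where uv: "quotient_of r = (u, v)" by force
  show "\<exists>u v. \<not> int p dvd v \<and> r = of_int u / of_int v"
    using r quotient_of_div[OF uv] uv by (auto simp: rat_p_integral_def)
qed (auto simp: rat_p_integral_Fract)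

lemma rat_p_integral_add:
  assumes "prime p" "rat_p_integral p r" "rat_p_integral p s"
  shows "rat_p_integral p (r + s)"
proof -
  obtain u v u' v' where uv: "\<not> int p dvd v" "r = of_int u / of_int v"
      "\<not> int p dvd v'" "s = of_int u' / of_int v'"
    using assms by (auto simp: rat_p_integral_iff)
  have "v \<noteq> 0" "v' \<noteq> 0" using uv by auto
  then have "r + s = of_int (u * v' + u' * v) / of_int (v * v')"
    using uv by (simp add: field_simps)
  moreover have "\<not> int p dvd v * v'"
    using uv assms(1) by (simp add: prime_dvd_mult_iff)
  ultimately show ?thesis unfolding rat_p_integral_iff by blast
qed

lemma rat_p_integral_mult:
  assumes "prime p" "rat_p_integral p r" "rat_p_integral p s"
  shows "rat_p_integral p (r * s)"
proof -
  obtain u v u' v' where uv: "\<not> int p dvd v" "r = of_int u / of_int v"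
      "\<not> int p dvd v'" "s = of_int u' / of_int v'"
    using assms by (auto simp: rat_p_integral_iff)
  have "r * s = of_int (u * u') / of_int (v * v')"
    using uv by simp
  moreover have "\<not> int p dvd v * v'"
    using uv assms(1) by (simp add: prime_dvd_mult_iff)
  ultimately show ?thesis unfolding rat_p_integral_iff by blast
qed

lemma rat_congI:
  assumes "rat_p_integral p r" "rat_p_integral p s" "rat_p_integral p t" "r - s = of_nat p * t"
  shows "rat_cong r s p"
  using assms by (auto simp: rat_cong_def rat_p_dvd_def)

lemma rat_congE:
  assumes "rat_cong r s p"
  obtains t where "rat_p_integral p r" "rat_p_integral p s" "rat_p_integral p t"
    "r - s = of_nat p * t"
  using assms by (auto simp: rat_cong_def rat_p_dvd_def)

lemma rat_cong_of_int:
  assumes "prime p" "[x = y] (mod int p)"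
  shows "rat_cong (of_int x) (of_int y) p"
proof -
  obtain k where "x - y = int p * k" using assms(2) by (auto simp: cong_iff_dvd_diff)
  then have "(of_int x - of_int y :: rat) = of_nat p * of_int k"
    by (metis of_int_diff of_int_mult of_int_of_nat_eq)
  then show ?thesis
    using rat_congI rat_p_integral_of_int[OF assms(1)] by blast
qed

lemma rat_cong_trans:
  assumes "prime p" "rat_cong r s p" "rat_cong s t p"
  shows "rat_cong r t p"
proof -
  obtain x where x: "rat_p_integral p r" "rat_p_integral p x" "r - s = of_nat p * x"
    using assms(2) by (rule rat_congE)
  obtain y where y: "rat_p_integral p t" "rat_p_integral p y" "s - t = of_nat p * y"
    using assms(3) by (rule rat_congE)
  have "r - t = of_nat p * (x + y)" using x y by (simp add: algebra_simps)
  then show ?thesis using x y assms(1) by (auto intro!: rat_congI[of _ _ _ "x + y"] rat_p_integral_add)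
qed

lemma rat_cong_add:
  assumes "prime p" "rat_cong r s p" "rat_cong r' s' p"
  shows "rat_cong (r + r') (s + s') p"
proof -
  obtain x where x: "rat_p_integral p r" "rat_p_integral p s" "rat_p_integral p x"
      "r - s = of_nat p * x"
    using assms(2) by (rule rat_congE)
  obtain y where y: "rat_p_integral p r'" "rat_p_integral p s'" "rat_p_integral p y"
      "r' - s' = of_nat p * y"
    using assms(3) by (rule rat_congE)
  have "(r + r') - (s + s') = of_nat p * (x + y)" using x y by (simp add: algebra_simps)
  then show ?thesis using x y assms(1) by (auto intro!: rat_congI[of _ _ _ "x + y"] rat_p_integral_add)
qed

lemma rat_cong_mult:
  assumes "prime p" "rat_cong r s p" "rat_cong r' s' p"
  shows "rat_cong (r * r') (s * s') p"
proof -
  obtain x where x: "rat_p_integral p r" "rat_p_integral p s" "rat_p_integral p x"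
      "r - s = of_nat p * x"
    using assms(2) by (rule rat_congE)
  obtain y where y: "rat_p_integral p r'" "rat_p_integral p s'" "rat_p_integral p y"
      "r' - s' = of_nat p * y"
    using assms(3) by (rule rat_congE)
  have "r * r' - s * s' = (r - s) * r' + s * (r' - s')" by (simp add: algebra_simps)
  also have "\<dots> = of_nat p * (x * r' + s * y)" unfolding x y by (simp add: algebra_simps)
  finally show ?thesis
    using x y assms(1)
    by (auto intro!: rat_congI[of _ _ _ "x * r' + s * y"] rat_p_integral_add rat_p_integral_mult)
qed

lemma rat_cong_power:
  assumes "prime p" "rat_cong r s p"
  shows "rat_cong (r ^ n) (s ^ n) p"
  using rat_cong_of_int[OF assms(1), of 1 1]
  by (induction n) (auto intro: rat_cong_mult assms)

lemma rat_cong_sum: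
  assumes "prime p" "\<And>i. i \<in> A \<Longrightarrow> rat_cong (f i) (g i) p"
  shows "rat_cong (sum f A) (sum g A) p"
  \<comment> \<open>The congruence of 0 with itself serves both the empty and the infinite index
    set.\<close>
  using assms(2) rat_cong_of_int[OF assms(1), of 0 0]
  by (induction A rule: infinite_finite_induct) (auto intro: rat_cong_add assms(1))

text \<open>By uniqueness of residues \<open>rat_residue p r\<close> is \<open>m mod int p\<close>,
  and being a multiple of \<open>p\<close> or a square depends only on the class modulo
  \<open>p\<close>. This carries symbols of rationals over to integers.\<close>

lemma rat_Legendre_eq_Legendre:
  assumes p: "prime p" and r: "rat_cong r (of_int m) p"
  shows "rat_Legendre r p = Legendre m (int p)"
proof -
  have "rat_cong (of_int m) (of_int (m mod int p)) p"
    using p by (intro rat_cong_of_int) auto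
  then have "rat_cong r (of_int (m mod int p)) p"
    using r p rat_cong_trans by blast
  moreover have "rat_p_integral p r" using r by (simp add: rat_cong_def)
  ultimately have "rat_residue p r = m mod int p"
    unfolding rat_residue_def using p prime_gt_0_nat[of p]
    by (intro the1_equality rat_residue_ex1) auto
  then show ?thesis
    by (simp add: rat_Legendre_def Legendre_def QuadRes_def cong_def)
qed

section \<open>Central binomial coefficients modulo \<open>p\<close>\<close>

text \<open>The ratio of consecutive central binomial coefficients, cleared of denominators; it
  drives the induction below.\<close>

lemma Suc_times_central_binomial_Suc:
  "Suc j * ((2 * Suc j) choose Suc j) = 2 * (2 * j + 1) * ((2 * j) choose j)"
proof -
  have "Suc j * ((2 * Suc j) choose Suc j) = Suc j * (Suc (Suc (2 * j)) choose Suc j)"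
    by simp
  also have "\<dots> = Suc (Suc (2 * j)) * (Suc (2 * j) choose j)"
    by (rule Suc_times_binomial)
  also have "\<dots> = 2 * (Suc j * (Suc (2 * j) choose j))"
    by (simp add: algebra_simps)
  also have "Suc (2 * j) choose j = Suc (2 * j) choose Suc j"
    using binomial_symmetric[of j "Suc (2 * j)"] by (simp add: Suc_diff_le)
  also have "Suc j * (Suc (2 * j) choose Suc j) = Suc (2 * j) * ((2 * j) choose j)"
    by (rule Suc_times_binomial)
  finally show ?thesis by simp
qed

text \<open>Both sides start at 1 and satisfy the same first-order recurrence modulo
  \<open>p\<close>: the factors \<open>4 * j + 2\<close> and \<open>-4 * (n - j)\<close> differ by
  \<open>4 * n + 2\<close>, which is \<open>2 * p\<close>.\<close>

lemma central_binomial_cong: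
  assumes "prime p" "p = 2 * n + 1" "j \<le> n"
  shows "[int ((2 * j) choose j) = (-4) ^ j * int (n choose j)] (mod int p)"
  using assms(3)
proof (induction j)
  case 0
  show ?case by simp
next
  case (Suc j)
  have "Suc j * (n choose Suc j) = (n - j) * (n choose j)"
    using binomial_absorb_comp[of n j] binomial_absorption[of j n] by (simp add: mult.commute)
  then have step: "int (Suc j) * int (n choose Suc j) = (int n - int j) * int (n choose j)"
    using Suc.prems by (metis Suc_leD of_nat_diff of_nat_mult)
  have "int (Suc j) * int ((2 * Suc j) choose Suc j) = (4 * int j + 2) * int ((2 * j) choose j)"
    unfolding of_nat_mult[symmetric] Suc_times_central_binomial_Suc
    by (simp add: algebra_simps)
  also have "[\<dots> = (4 * int j + 2) * ((-4) ^ j * int (n choose j))] (mod int p)"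
    using Suc by (intro cong_scalar_left) auto
  also have "[(4 * int j + 2) * ((-4) ^ j * int (n choose j))
      = (-4 * (int n - int j)) * ((-4) ^ j * int (n choose j))] (mod int p)"
  proof (intro cong_scalar_right)
    have "4 * int j + 2 - (-4 * (int n - int j)) = int p * 2"
      using assms(2) by simp
    then show "[4 * int j + 2 = -4 * (int n - int j)] (mod int p)"
      by (simp only: cong_iff_dvd_diff dvd_triv_left)
  qed
  also have "(-4 * (int n - int j)) * ((-4) ^ j * int (n choose j))
      = (-4) ^ Suc j * ((int n - int j) * int (n choose j))"
    by (simp only: power_Suc mult_ac)
  also have "\<dots> = int (Suc j) * ((-4) ^ Suc j * int (n choose Suc j))"
    unfolding step[symmetric] by (simp only: mult_ac)
  finally have "[int (Suc j) * int ((2 * Suc j) choose Suc j)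
      = int (Suc j) * ((-4) ^ Suc j * int (n choose Suc j))] (mod int p)" .
  \<comment> \<open>Here \<open>Suc j \<le> n < p\<close>, so the leading factor can be cancelled
    modulo \<open>p\<close>.\<close>
  moreover have "\<not> p dvd Suc j"
    using Suc.prems assms(2) by (auto dest: dvd_imp_le)
  then have "coprime (int (Suc j)) (int p)"
    using assms(1) by (metis coprime_commute coprime_int_iff prime_imp_coprime)
  ultimately show ?case by (simp only: cong_mult_lcancel)
qed

text \<open>The binomial theorem collapses the reduced sum to a power of \<open>1 - 4 * x\<close>
  whose exponent \<open>n = (p - 1) div 2\<close> is the one in Euler's criterion.\<close>

lemma sum_central_binomial_cong_Legendre:
  assumes "prime p" "p = 2 * n + 1"
  shows "[(\<Sum>j\<le>n. int ((2 * j) choose j) * x ^ j) = Legendre (1 - 4 * x) (int p)] (mod int p)"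
proof -
  have "[(\<Sum>j\<le>n. int ((2 * j) choose j) * x ^ j)
      = (\<Sum>j\<le>n. (-4) ^ j * int (n choose j) * x ^ j)] (mod int p)"
    using assms by (intro cong_sum cong_scalar_right central_binomial_cong) auto
  also have "(\<Sum>j\<le>n. (-4) ^ j * int (n choose j) * x ^ j) = (-4 * x + 1) ^ n"
    unfolding binomial_ring[of "-4 * x" 1 n]
    by (intro sum.cong) (simp_all only: power_mult_distrib power_one mult_1_right mult_ac)
  also have "\<dots> = (1 - 4 * x) ^ ((p - 1) div 2)" using assms(2) by simp
  also have "[\<dots> = Legendre (1 - 4 * x) (int p)] (mod int p)"
    using assms prime_gt_1_nat[of p] by (intro cong_sym[OF euler_criterion]) auto
  finally show ?thesis .
qed

section \<open>The even part of the generating polynomial\<close>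

text \<open>Adding the values at \<open>x\<close> and \<open>- x\<close> cancels the odd powers and
  doubles the even ones. Keeping the factor 2 avoids division in the integers.\<close>

lemma two_times_sum_even:
  fixes f :: "nat \<Rightarrow> int"
  shows "2 * (\<Sum>k=0..n div 2. f (2 * k) * x ^ (2 * k))
    = (\<Sum>j\<le>n. f j * x ^ j) + (\<Sum>j\<le>n. f j * (- x) ^ j)"
proof -
  have "(\<Sum>j\<le>n. f j * x ^ j) + (\<Sum>j\<le>n. f j * (- x) ^ j)
      = (\<Sum>j\<le>n. if even j then 2 * (f j * x ^ j) else 0)"
    by (subst sum.distrib[symmetric], intro sum.cong) auto
  also have "\<dots> = (\<Sum>j | j \<le> n \<and> even j. 2 * (f j * x ^ j))"
    by (subst sum.inter_filter[symmetric]) auto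
  also have "\<dots> = (\<Sum>k=0..n div 2. 2 * (f (2 * k) * x ^ (2 * k)))"
    by (rule sum.reindex_bij_witness[of _ "\<lambda>k. 2 * k" "\<lambda>j. j div 2"]) auto
  finally show ?thesis by (simp add: sum_distrib_left)
qed

lemma two_times_sum_binomial_4k_2k_cong:
  fixes x :: int
  assumes "prime p" "odd p"
  shows "[2 * (\<Sum>k=0..p div 4. int ((4 * k) choose (2 * k)) * x ^ (2 * k))
    = Legendre (1 - 4 * x) (int p) + Legendre (1 + 4 * x) (int p)] (mod int p)"
proof -
  obtain n where n: "p = 2 * n + 1" using assms(2) by (elim oddE)
  \<comment> \<open>Thus the cutoff \<open>p div 4\<close> takes in exactly the even indices up to
    \<open>n\<close>.\<close>
  have "p div 4 = n div 2" using n by presburger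
  then have "2 * (\<Sum>k=0..p div 4. int ((4 * k) choose (2 * k)) * x ^ (2 * k))
      = (\<Sum>j\<le>n. int ((2 * j) choose j) * x ^ j) + (\<Sum>j\<le>n. int ((2 * j) choose j) * (- x) ^ j)"
    using two_times_sum_even[of "\<lambda>j. int ((2 * j) choose j)" x n] by simp
  then show ?thesis
    using cong_add[OF sum_central_binomial_cong_Legendre[OF assms(1) n, of x]
        sum_central_binomial_cong_Legendre[OF assms(1) n, of "- x"]] by simp
qed

section \<open>Values and multiplicativity of the Legendre symbol\<close>

lemma Legendre_range: "Legendre x q \<in> {-1, 0, 1}"
  by (simp add: Legendre_def)

text \<open>Euler's criterion gives the equation modulo \<open>p\<close>; the two sides differ by at
  most 2, which is less than \<open>p\<close>, so they are equal.\<close>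

lemma Legendre_mult_odd_prime:
  assumes "prime p" "odd p"
  shows "Legendre (x * y) (int p) = Legendre x (int p) * Legendre y (int p)"
proof -
  have p: "2 < p" using assms prime_ge_2_nat[of p] by (cases "p = 2") auto
  have "[Legendre (x * y) (int p) = (x * y) ^ ((p - 1) div 2)] (mod int p)"
    using euler_criterion[OF assms(1) p] .
  also have "(x * y) ^ ((p - 1) div 2) = x ^ ((p - 1) div 2) * y ^ ((p - 1) div 2)"
    by (simp add: power_mult_distrib)
  also have "[\<dots> = Legendre x (int p) * Legendre y (int p)] (mod int p)"
    by (intro cong_mult cong_sym[OF euler_criterion[OF assms(1) p]])
  finally have "int p dvd Legendre (x * y) (int p) - Legendre x (int p) * Legendre y (int p)"
    by (simp add: cong_iff_dvd_diff)
  moreover have "\<bar>l - l' * l''\<bar> < int p"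
    if "l \<in> {-1, 0, 1}" "l' \<in> {-1, 0, 1}" "l'' \<in> {-1, 0, 1}" for l l' l''
    using p that by auto
  then have "\<bar>Legendre (x * y) (int p) - Legendre x (int p) * Legendre y (int p)\<bar> < int p"
    by (meson Legendre_range)
  ultimately have "Legendre (x * y) (int p) - Legendre x (int p) * Legendre y (int p) = 0"
    using dvd_imp_le_int[of _ "int p"] by (metis abs_of_nat linorder_not_less)
  then show ?thesis by simp
qed

section \<open>Passage from the rational argument to an integer, and the two cases\<close>

theorem theorem2p9:
  fixes p :: nat and a :: rat
  assumes "prime p" and "odd p"
    and "rat_p_integral p a"
    and "\<not> rat_p_dvd p (16 * a\<^sup>2 - 1)"
  shows "(rat_Legendre (1 - 16 * a\<^sup>2) p = -1 \<longrightarrow>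
            rat_cong (\<Sum>k=0..p div 4. of_nat ((4 * k) choose (2 * k)) * a ^ (2 * k)) 0 p) \<and>
         (rat_Legendre (1 - 16 * a\<^sup>2) p = 1 \<longrightarrow>
            rat_cong (\<Sum>k=0..p div 4. of_nat ((4 * k) choose (2 * k)) * a ^ (2 * k))
              (of_int (rat_Legendre (1 - 4 * a) p)) p)"
proof -
  note p = assms(1)
  \<comment> \<open>Replacing \<open>a\<close> by an integer \<open>m\<close> in its residue class
    reduces the sum and all the symbols to integers.\<close>
  obtain m where m: "rat_cong a (of_int m) p"
    using rat_residue_ex1[OF p assms(3)] by blast
  have const: "rat_cong (of_int c) (of_int c) p" for c
    by (rule rat_cong_of_int[OF p]) simp
  define S where "S = (\<Sum>k=0..p div 4. int ((4 * k) choose (2 * k)) * m ^ (2 * k))"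
  define L where "L = Legendre (1 - 4 * m) (int p)"
  define L' where "L' = Legendre (1 + 4 * m) (int p)"
  have sum: "rat_cong (\<Sum>k=0..p div 4. of_nat ((4 * k) choose (2 * k)) * a ^ (2 * k)) (of_int S) p"
    unfolding S_def of_int_sum of_int_mult of_int_power of_int_of_nat_eq
    using const[of "int _"]
    by (intro rat_cong_sum[OF p] rat_cong_mult[OF p] rat_cong_power[OF p] m) simp
  have L: "rat_Legendre (1 - 4 * a) p = L"
    unfolding L_def
    \<comment> \<open>Reading \<open>1 - 4 * a\<close> as \<open>1 + (-4) * a\<close> makes it a
      matter of sums and products of congruences.\<close>
    using rat_cong_add[OF p const[of 1] rat_cong_mult[OF p const[of "-4"] m]]
    by (intro rat_Legendre_eq_Legendre[OF p]) simp
  have "rat_Legendre (1 - 16 * a\<^sup>2) p = Legendre (1 - 16 * m\<^sup>2) (int p)"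
    using rat_cong_add[OF p const[of 1]
        rat_cong_mult[OF p const[of "-16"] rat_cong_power[OF p m, of 2]]]
    by (intro rat_Legendre_eq_Legendre[OF p]) simp
  also have "1 - 16 * m\<^sup>2 = (1 - 4 * m) * (1 + 4 * m)"
    by (simp add: algebra_simps power2_eq_square)
  finally have LL': "rat_Legendre (1 - 16 * a\<^sup>2) p = L * L'"
    by (simp add: Legendre_mult_odd_prime[OF p assms(2)] L_def L'_def)
  have range: "L \<in> {-1, 0, 1}" "L' \<in> {-1, 0, 1}"
    unfolding L_def L'_def by (rule Legendre_range)+
  have twice: "[2 * S = L + L'] (mod int p)"
    using two_times_sum_binomial_4k_2k_cong[OF p assms(2), of m]
    by (simp add: S_def L_def L'_def)
  have coprime: "coprime 2 (int p)" using assms(2) by simp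
  have "[S = 0] (mod int p)" if "L * L' = -1"
  proof -
    \<comment> \<open>Product -1 forces the symbols to be 1 and -1 in some order. The zero is
      written as \<open>2 * 0\<close> so that the invertible factor 2 can be cancelled against
      \<open>twice\<close>.\<close>
    have "L + L' = 2 * 0" using range that by auto
    then show ?thesis using twice cong_mult_lcancel[OF coprime] by metis
  qed
  moreover have "[S = L] (mod int p)" if "L * L' = 1"
  proof -
    \<comment> \<open>Product 1 forces the two symbols to be equal.\<close>
    have "L + L' = 2 * L" using range that by auto
    then show ?thesis using twice cong_mult_lcancel[OF coprime] by metis
  qed
  ultimately show ?thesis
    unfolding LL' L
    using rat_cong_trans[OF p sum rat_cong_of_int[OF p, of S 0]]
      rat_cong_trans[OF p sum rat_cong_of_int[OF p, of S L]] by simp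
qed

end
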